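(* For every integer $r\ge2$, the graph $N_r=K_r\vee(K_2\sqcup 2K_1)$ is connected and nice but not strongly nice.
   Context: For a finite simple graph $G=(V,E)$, the chromatic symmetric function is $X_G=\sum_{\kappa}\prod_{v\in V}x_{\kappa(v)}$, where the sum ranges over all proper colorings $\kappa:V\to\mathbb N=\{1,2,\ldots\}$. Write $X_G=\sum_{\lambda\vdash |V|}a_\lambda(G)m_\lambda$, where $m_\lambda$ are the monomial symmetric functions. For partitions $\lambda,\mu\vdash n$, $\lambda\ge\mu$ (dominance order) means $\sum_{i=1}^k\lambda_i\ge\sum_{i=1}^k\mu_i$ for every $k\ge1$ (parts beyond the length are $0$). $G$ is nice if for all $\lambda,\mu\vdash|V(G)|$ with $\lambda\ge\mu$, $a_\lambda(G)>0$ implies $a_\mu(G)>0$. $G$ is strongly nice if $a_\lambda(G)\le a_\mu(G)$ for all $\lambda,\mu\vdash|V(G)|$ with $\lambda\ge\mu$. $K_n$ is the complete graph on $n$ vertices, $\sqcup$ is disjoint union, and $2K_1$ is the graph with two vertices and no edges. The join $G\vee H$ of two vertex-disjoint graphs is obtained from $G\sqcup H$ by adding every edge between the two vertex sets. *)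

theory Defs
  imports "Graph_Theory.Graph_Theory" "HOL-Library.Poly_Mapping" "HOL-Library.FuncSet"
    "HOL-Combinatorics.Permutations"
begin

(* A finite simple graph is a \<open>pair_graph\<close>: a finite, loopfree, symmetric
   relation \<open>parcs G\<close> on a finite vertex set \<open>pverts G\<close>; an undirected edge uv
   is the pair of arcs (u,v), (v,u). *)

definition complete_graph :: "nat \<Rightarrow> nat pair_pre_digraph" where
  "complete_graph n = \<lparr> pverts = {..<n}, parcs = {(u, v). u < n \<and> v < n \<and> u \<noteq> v} \<rparr>"

definition edgeless_graph :: "nat \<Rightarrow> nat pair_pre_digraph" where
  "edgeless_graph n = \<lparr> pverts = {..<n}, parcs = {} \<rparr>"

(* The sum type makes the two vertex sets disjoint. *)
definition graph_disj_union ::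
  "'a pair_pre_digraph \<Rightarrow> 'b pair_pre_digraph \<Rightarrow> ('a + 'b) pair_pre_digraph" where
  "graph_disj_union G H =
     \<lparr> pverts = Inl ` pverts G \<union> Inr ` pverts H,
       parcs = map_prod Inl Inl ` parcs G \<union> map_prod Inr Inr ` parcs H \<rparr>"

definition graph_join ::
  "'a pair_pre_digraph \<Rightarrow> 'b pair_pre_digraph \<Rightarrow> ('a + 'b) pair_pre_digraph" where
  "graph_join G H =
     \<lparr> pverts = pverts (graph_disj_union G H),
       parcs = parcs (graph_disj_union G H)
         \<union> (Inl ` pverts G) \<times> (Inr ` pverts H) \<union> (Inr ` pverts H) \<times> (Inl ` pverts G) \<rparr>"

definition N_graph :: "nat \<Rightarrow> (nat + nat + nat) pair_pre_digraph" where
  "N_graph r =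
     graph_join (complete_graph r) (graph_disj_union (complete_graph 2) (edgeless_graph 2))"

definition partitions_of :: "nat \<Rightarrow> nat list set" where
  "partitions_of n = {p. sorted_wrt (\<ge>) p \<and> 0 \<notin> set p \<and> sum_list p = n}"

definition dominates :: "nat list \<Rightarrow> nat list \<Rightarrow> bool" where
  "dominates p q \<longleftrightarrow> (\<forall>k\<ge>1. sum_list (take k q) \<le> sum_list (take k p))"

(* A formal power series over the integers in the variables x_1, x_2, ... is the
   function sending each monomial to its coefficient; a monomial is its finitely
   supported exponent vector. Index 0 is not a variable. *)
type_synonym monomial = "nat \<Rightarrow>\<^sub>0 nat"
type_synonym power_series = "monomial \<Rightarrow> int"

definition proper_colorings :: "'a pair_pre_digraph \<Rightarrow> ('a \<Rightarrow> nat) set" where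
  "proper_colorings G =
     {c \<in> pverts G \<rightarrow>\<^sub>E {1..}. \<forall>(u, v) \<in> parcs G. c u \<noteq> c v}"

(* The exponent vector of the product of the x_{c(v)} over all vertices v. *)
definition coloring_monomial :: "'a pair_pre_digraph \<Rightarrow> ('a \<Rightarrow> nat) \<Rightarrow> monomial" where
  "coloring_monomial G c = (\<Sum>v\<in>pverts G. Poly_Mapping.single (c v) 1)"

(* The formal sum of these monomials: each coefficient counts finitely many colorings. *)
definition chromatic_symfun :: "'a pair_pre_digraph \<Rightarrow> power_series" where
  "chromatic_symfun G m = int (card {c \<in> proper_colorings G. coloring_monomial G c = m})"

definition exponents :: "monomial \<Rightarrow> nat multiset" where
  "exponents m = image_mset (Poly_Mapping.lookup m) (mset_set (Poly_Mapping.keys m))"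

definition monomial_symfun :: "nat list \<Rightarrow> power_series" where
  "monomial_symfun p m =
     (if Poly_Mapping.keys m \<subseteq> {1..} \<and> exponents m = mset p then 1 else 0)"

(* Coefficients are set to 0 at lists that are not partitions of the number of vertices. *)
definition is_monomial_expansion :: "'a pair_pre_digraph \<Rightarrow> (nat list \<Rightarrow> int) \<Rightarrow> bool" where
  "is_monomial_expansion G a \<longleftrightarrow>
     (\<forall>p. p \<notin> partitions_of (card (pverts G)) \<longrightarrow> a p = 0) \<and>
     (\<forall>m. chromatic_symfun G m =
        (\<Sum>p\<in>partitions_of (card (pverts G)). a p * monomial_symfun p m))"

(* Well defined by \<open>ex1_monomial_expansion\<close> below. *)
definition monomial_coeff :: "'a pair_pre_digraph \<Rightarrow> nat list \<Rightarrow> int" where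
  "monomial_coeff G = (THE a. is_monomial_expansion G a)"

definition nice :: "'a pair_pre_digraph \<Rightarrow> bool" where
  "nice G \<longleftrightarrow>
     (\<forall>p \<in> partitions_of (card (pverts G)). \<forall>q \<in> partitions_of (card (pverts G)).
        dominates p q \<longrightarrow> monomial_coeff G p > 0 \<longrightarrow> monomial_coeff G q > 0)"

definition strongly_nice :: "'a pair_pre_digraph \<Rightarrow> bool" where
  "strongly_nice G \<longleftrightarrow>
     (\<forall>p \<in> partitions_of (card (pverts G)). \<forall>q \<in> partitions_of (card (pverts G)).
        dominates p q \<longrightarrow> monomial_coeff G p \<le> monomial_coeff G q)"


section \<open>Existence and uniqueness of the monomial expansion\<close>

lemma finite_partitions_of: "finite (partitions_of n)"
proof (rule finite_subset)
  have len: "length p \<le> sum_list p" if "0 \<notin> set p" for p :: "nat list"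
    using that by (induction p) auto
  show "partitions_of n \<subseteq> {p. set p \<subseteq> {..n} \<and> length p \<le> n}"
    using len member_le_sum_list by (fastforce simp: partitions_of_def)
  show "finite {p. set p \<subseteq> {..n} \<and> length p \<le> n}"
    by (rule finite_lists_length_le) simp
qed

lemma partitions_of_eqI:
  assumes "p \<in> partitions_of n" "q \<in> partitions_of n'" "mset p = mset q"
  shows "p = q"
proof -
  have "sorted (rev p)" "sorted (rev q)"
    using assms by (simp_all add: partitions_of_def sorted_wrt_rev)
  moreover have "mset (rev p) = mset (rev q)" using assms by simp
  ultimately have "rev p = rev q"
    by (metis properties_for_sort)
  thus ?thesis by simp
qed

lemma ex_partition_mset:
  assumes "0 \<notin># M"
  shows "\<exists>p \<in> partitions_of (sum_mset M). mset p = M"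
proof (rule bexI)
  let ?p = "rev (sorted_list_of_multiset M)"
  show m: "mset ?p = M" by simp
  show "?p \<in> partitions_of (sum_mset M)"
    using assms sum_mset_sum_list[of ?p] m
    by (simp add: partitions_of_def sorted_wrt_rev)
qed

lemma ex_monomial_exponents:
  assumes "0 \<notin> set p"
  shows "\<exists>m. Poly_Mapping.keys m \<subseteq> {1..} \<and> exponents m = mset p"
proof -
  define m where "m = Poly_Mapping.Abs_poly_mapping
    (\<lambda>i. if i \<in> {1..length p} then p ! (i - 1) else 0)"
  have l: "Poly_Mapping.lookup m = (\<lambda>i. if i \<in> {1..length p} then p ! (i - 1) else 0)"
    unfolding m_def
    by (rule Poly_Mapping.lookup_Abs_poly_mapping, rule finite_subset[of _ "{1..length p}"]) auto
  have nz: "p ! i \<noteq> 0" if "i < length p" for i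
    using assms that by (metis nth_mem)
  have k: "Poly_Mapping.keys m = Suc ` {..<length p}"
  proof -
    have "i \<in> Poly_Mapping.keys m \<longleftrightarrow> i \<in> {1..length p}" for i
      using nz[of "i - 1"] by (auto simp: in_keys_iff l)
    moreover have "Suc ` {..<length p} = {1..length p}"
      by (simp add: lessThan_atLeast0 image_Suc_atLeastLessThan atLeastLessThanSuc_atLeastAtMost)
    ultimately show ?thesis by auto
  qed
  have "exponents m = image_mset (Poly_Mapping.lookup m) (image_mset Suc (mset_set {..<length p}))"
    unfolding exponents_def k by (simp add: image_mset_mset_set)
  also have "\<dots> = image_mset (\<lambda>i. p ! i) (mset_set {..<length p})"
    unfolding multiset.map_comp by (rule image_mset_cong) (simp add: l Suc_le_eq)
  also have "\<dots> = mset (map (\<lambda>i. p ! i) [0..<length p])"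
    by (simp add: mset_map lessThan_atLeast0)
  finally have "exponents m = mset p" by (simp add: map_nth)
  moreover have "Poly_Mapping.keys m \<subseteq> {1..}" unfolding k by auto
  ultimately show ?thesis by blast
qed

lemma coloring_monomial_lookup:
  assumes "finite (pverts G)"
  shows "Poly_Mapping.lookup (coloring_monomial G c) i = card {v \<in> pverts G. c v = i}"
  using assms by (simp add: coloring_monomial_def lookup_sum lookup_single when_def
      sum.If_cases Int_def)

lemma keys_coloring_monomial:
  assumes "finite (pverts G)"
  shows "Poly_Mapping.keys (coloring_monomial G c) = c ` pverts G"
  using assms by (auto simp: in_keys_iff coloring_monomial_lookup)

lemma sum_exponents_coloring_monomial:
  assumes "finite (pverts G)"
  shows "sum_mset (exponents (coloring_monomial G c)) = card (pverts G)"
proof -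
  have "sum_mset (exponents (coloring_monomial G c))
      = (\<Sum>i\<in>c ` pverts G. card {v \<in> pverts G. c v = i})"
    unfolding exponents_def keys_coloring_monomial[OF assms] sum_unfold_sum_mset
    using coloring_monomial_lookup[OF assms] by (simp cong: image_mset_cong)
  also have "\<dots> = (\<Sum>i\<in>c ` pverts G. \<Sum>v\<in>{v \<in> pverts G. c v = i}. 1)" by simp
  also have "\<dots> = (\<Sum>v\<in>pverts G. 1)"
    using assms by (subst sum.image_gen[of "pverts G" _ c]) auto
  finally show ?thesis by simp
qed

lemma finite_colorings_with_monomial:
  assumes "finite (pverts G)"
  shows "finite {c \<in> proper_colorings G. coloring_monomial G c = m}"
proof (rule finite_subset)
  show "{c \<in> proper_colorings G. coloring_monomial G c = m}
      \<subseteq> pverts G \<rightarrow>\<^sub>E Poly_Mapping.keys m"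
    using keys_coloring_monomial[OF assms]
    by (auto simp: proper_colorings_def PiE_iff extensional_def)
  show "finite (pverts G \<rightarrow>\<^sub>E Poly_Mapping.keys m)"
    using assms by (intro finite_PiE) auto
qed

lemma zero_notin_exponents: "0 \<notin># exponents m"
  by (auto simp: exponents_def in_keys_iff)

lemma exponents_eq_permutes:
  assumes "exponents m = exponents m'"
  obtains f where "f permutes (Poly_Mapping.keys m \<union> Poly_Mapping.keys m')"
    "\<And>i. Poly_Mapping.lookup m i = Poly_Mapping.lookup m' (f i)"
proof -
  define A where "A = Poly_Mapping.keys m \<union> Poly_Mapping.keys m'"
  have fin: "finite A" by (simp add: A_def)
  have pad: "image_mset (Poly_Mapping.lookup n) (mset_set A)
      = exponents n + replicate_mset (card A - card (Poly_Mapping.keys n)) 0"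
    if "Poly_Mapping.keys n \<subseteq> A" for n :: monomial
  proof -
    have "A = Poly_Mapping.keys n \<union> (A - Poly_Mapping.keys n)" using that by auto
    hence "mset_set A = mset_set (Poly_Mapping.keys n) + mset_set (A - Poly_Mapping.keys n)"
      using fin by (metis Diff_disjoint finite_Diff finite_keys mset_set_Union)
    moreover have "image_mset (Poly_Mapping.lookup n) (mset_set (A - Poly_Mapping.keys n))
        = image_mset (\<lambda>_. 0) (mset_set (A - Poly_Mapping.keys n))"
      by (rule image_mset_cong) (use fin in \<open>auto simp: in_keys_iff\<close>)
    moreover have "card (A - Poly_Mapping.keys n) = card A - card (Poly_Mapping.keys n)"
      using that by (simp add: card_Diff_subset)
    ultimately show ?thesis by (simp add: exponents_def image_mset_const_eq)
  qed
  have "card (Poly_Mapping.keys m) = card (Poly_Mapping.keys m')"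
    using arg_cong[OF assms, of size] by (simp add: exponents_def)
  hence "image_mset (Poly_Mapping.lookup m) (mset_set A)
      = image_mset (Poly_Mapping.lookup m') (mset_set A)"
    using pad[of m] pad[of m'] assms by (simp add: A_def)
  then obtain f where f: "f permutes A"
      "\<forall>i\<in>A. Poly_Mapping.lookup m i = Poly_Mapping.lookup m' (f i)"
    using image_mset_eq_implies_permutes[OF fin] by metis
  have "Poly_Mapping.lookup m i = Poly_Mapping.lookup m' (f i)" for i
  proof (cases "i \<in> A")
    case False
    hence "f i = i" using f(1) by (simp add: permutes_not_in)
    with False show ?thesis by (simp add: A_def in_keys_iff)
  qed (use f in auto)
  with f(1) that show thesis by (simp add: A_def)
qed

lemma card_colorings_le:
  assumes "pair_graph G" "Poly_Mapping.keys m \<subseteq> {1..}" "Poly_Mapping.keys m' \<subseteq> {1..}"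
    "exponents m = exponents m'"
  shows "card {c \<in> proper_colorings G. coloring_monomial G c = m}
    \<le> card {c \<in> proper_colorings G. coloring_monomial G c = m'}"
proof -
  interpret pair_graph G by fact
  have fin: "finite (pverts G)" by (rule pair_finite_verts)
  obtain f where f: "f permutes (Poly_Mapping.keys m \<union> Poly_Mapping.keys m')"
      "\<And>i. Poly_Mapping.lookup m i = Poly_Mapping.lookup m' (f i)"
    using exponents_eq_permutes[OF assms(4)] by metis
  have inj: "inj f" using f(1) by (rule permutes_inj)
  have pos: "f i \<in> {1..}" if "i \<in> {1..}" for i
  proof -
    have "f permutes {1..}"
      by (rule permutes_subset[OF f(1)]) (use assms(2,3) in blast)
    thus ?thesis using that by (simp only: permutes_in_image)
  qed
  let ?g = "\<lambda>c. restrict (\<lambda>v. f (c v)) (pverts G)"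
  show ?thesis
  proof (rule card_inj_on_le)
    show "inj_on ?g {c \<in> proper_colorings G. coloring_monomial G c = m}"
    proof (rule inj_onI)
      fix c d assume cd: "c \<in> {c \<in> proper_colorings G. coloring_monomial G c = m}"
        "d \<in> {c \<in> proper_colorings G. coloring_monomial G c = m}" and eq: "?g c = ?g d"
      have "c v = d v" if "v \<in> pverts G" for v
        using fun_cong[OF eq, of v] that inj by (simp add: inj_eq)
      thus "c = d" using cd by (auto simp: proper_colorings_def intro: PiE_ext)
    qed
    show "?g ` {c \<in> proper_colorings G. coloring_monomial G c = m}
      \<subseteq> {c \<in> proper_colorings G. coloring_monomial G c = m'}"
    proof (rule image_subsetI)
      fix c assume "c \<in> {c \<in> proper_colorings G. coloring_monomial G c = m}"
      hence c: "c \<in> proper_colorings G" "coloring_monomial G c = m" by auto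
      have "?g c \<in> pverts G \<rightarrow>\<^sub>E {1..}"
        using c(1) pos by (simp add: proper_colorings_def PiE_iff)
      moreover have "?g c u \<noteq> ?g c v" if "(u, v) \<in> parcs G" for u v
        using c(1) that in_arcsD1[OF that] in_arcsD2[OF that]
        by (auto simp: proper_colorings_def inj_eq[OF inj])
      ultimately have "?g c \<in> proper_colorings G"
        unfolding proper_colorings_def by blast
      moreover have "coloring_monomial G (?g c) = m'"
      proof (rule poly_mapping_eqI)
        fix j
        obtain i where j: "j = f i" using permutes_surj[OF f(1)] by (metis surjD)
        have "{v \<in> pverts G. ?g c v = j} = {v \<in> pverts G. c v = i}"
          using inj by (auto simp: j inj_eq)
        thus "Poly_Mapping.lookup (coloring_monomial G (?g c)) j = Poly_Mapping.lookup m' j"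
          using f(2)[of i] c(2) coloring_monomial_lookup[OF fin] j by metis
      qed
      ultimately show "?g c \<in> {c \<in> proper_colorings G. coloring_monomial G c = m'}" by simp
    qed
    show "finite {c \<in> proper_colorings G. coloring_monomial G c = m'}"
      by (rule finite_colorings_with_monomial[OF fin])
  qed
qed

lemma chromatic_symfun_symmetric:
  assumes "pair_graph G" "Poly_Mapping.keys m \<subseteq> {1..}" "Poly_Mapping.keys m' \<subseteq> {1..}"
    "exponents m = exponents m'"
  shows "chromatic_symfun G m = chromatic_symfun G m'"
  using card_colorings_le[OF assms] card_colorings_le[OF assms(1,3,2) assms(4)[symmetric]]
  by (simp add: chromatic_symfun_def)

lemma chromatic_symfun_nonzero:
  assumes "finite (pverts G)" "chromatic_symfun G m \<noteq> 0"
  shows "Poly_Mapping.keys m \<subseteq> {1..}" "sum_mset (exponents m) = card (pverts G)"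
proof -
  have "{c \<in> proper_colorings G. coloring_monomial G c = m} \<noteq> {}"
    using assms(2) by (metis card.empty chromatic_symfun_def of_nat_0)
  then obtain c where c: "c \<in> proper_colorings G" "coloring_monomial G c = m" by auto
  show "Poly_Mapping.keys m \<subseteq> {1..}"
    using c keys_coloring_monomial[OF assms(1), of c]
    by (auto simp: proper_colorings_def PiE_iff)
  show "sum_mset (exponents m) = card (pverts G)"
    using c sum_exponents_coloring_monomial[OF assms(1), of c] by simp
qed

lemma sum_monomial_symfun:
  assumes "p \<in> partitions_of n" "Poly_Mapping.keys m \<subseteq> {1..}" "exponents m = mset p"
  shows "(\<Sum>q\<in>partitions_of n. a q * monomial_symfun q m) = a p"
proof -
  have "(\<Sum>q\<in>partitions_of n. a q * monomial_symfun q m)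
      = (\<Sum>q\<in>partitions_of n. if q = p then a q else 0)"
    by (rule sum.cong)
      (use assms partitions_of_eqI[OF assms(1)] in \<open>auto simp: monomial_symfun_def\<close>)
  thus ?thesis using assms(1) finite_partitions_of by simp
qed

lemma monomial_expansion_coeff:
  assumes "is_monomial_expansion G a" "p \<in> partitions_of (card (pverts G))"
    "Poly_Mapping.keys m \<subseteq> {1..}" "exponents m = mset p"
  shows "a p = chromatic_symfun G m"
  using assms sum_monomial_symfun[OF assms(2-4), of a]
  by (simp add: is_monomial_expansion_def)

theorem ex1_monomial_expansion:
  assumes "pair_graph G"
  shows "\<exists>!a. is_monomial_expansion G a"
proof (rule ex_ex1I)
  interpret pair_graph G by fact
  have fin: "finite (pverts G)" by (rule pair_finite_verts)
  let ?P = "partitions_of (card (pverts G))"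
  have ex: "\<exists>m. Poly_Mapping.keys m \<subseteq> {1..} \<and> exponents m = mset p" if "p \<in> ?P" for p
    using that ex_monomial_exponents by (simp add: partitions_of_def)
  then obtain mon where mon: "Poly_Mapping.keys (mon p) \<subseteq> {1..}" "exponents (mon p) = mset p"
    if "p \<in> ?P" for p by metis
  define a where "a p = (if p \<in> ?P then chromatic_symfun G (mon p) else 0)" for p
  have "chromatic_symfun G m = (\<Sum>p\<in>?P. a p * monomial_symfun p m)" for m
  proof (cases "Poly_Mapping.keys m \<subseteq> {1..} \<and> sum_mset (exponents m) = card (pverts G)")
    case True
    then obtain p where p: "p \<in> ?P" "exponents m = mset p"
      using ex_partition_mset[OF zero_notin_exponents, of m] by metis
    have "(\<Sum>p\<in>?P. a p * monomial_symfun p m) = chromatic_symfun G (mon p)"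
      using sum_monomial_symfun[OF p(1) _ p(2), of a] True p(1) by (simp add: a_def)
    also have "\<dots> = chromatic_symfun G m"
      using chromatic_symfun_symmetric[OF assms] mon[OF p(1)] p(2) True by metis
    finally show ?thesis ..
  next
    case False
    have "monomial_symfun p m = 0" if "p \<in> ?P" for p
      using that False by (auto simp: monomial_symfun_def partitions_of_def sum_mset_sum_list)
    moreover have "chromatic_symfun G m = 0"
      using False chromatic_symfun_nonzero[OF fin] by metis
    ultimately show ?thesis by simp
  qed
  moreover have "\<forall>p. p \<notin> ?P \<longrightarrow> a p = 0" by (simp add: a_def)
  ultimately have "is_monomial_expansion G a" unfolding is_monomial_expansion_def by blast
  thus "\<exists>a. is_monomial_expansion G a" by blast
  fix a b assume ab: "is_monomial_expansion G a" "is_monomial_expansion G b"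
  show "a = b"
  proof
    fix p
    show "a p = b p"
    proof (cases "p \<in> ?P")
      case True
      then show ?thesis
        using monomial_expansion_coeff[OF ab(1) True mon[OF True]]
          monomial_expansion_coeff[OF ab(2) True mon[OF True]] by simp
    qed (use ab in \<open>simp add: is_monomial_expansion_def\<close>)
  qed
qed

corollary is_monomial_expansion_monomial_coeff:
  assumes "pair_graph G"
  shows "is_monomial_expansion G (monomial_coeff G)"
  unfolding monomial_coeff_def by (rule theI'[OF ex1_monomial_expansion[OF assms]])


section \<open>The graphs are finite simple graphs\<close>

lemma complete_graph_is_complete: "K\<^bsub>n\<^esub> (with_proj (complete_graph n))"
  by (auto simp: complete_digraph_pair_def complete_graph_def)

lemma pair_graph_complete_graph: "pair_graph (complete_graph n)"
proof
  show "finite (parcs (complete_graph n))"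
    by (rule finite_subset[of _ "{..<n} \<times> {..<n}"]) (auto simp: complete_graph_def)
qed (auto simp: complete_graph_def symmetric_def sym_def)

lemma pair_graph_edgeless_graph: "pair_graph (edgeless_graph n)"
  by unfold_locales (auto simp: edgeless_graph_def symmetric_def sym_def)

lemma pair_graph_disj_union:
  assumes "pair_graph G" "pair_graph H"
  shows "pair_graph (graph_disj_union G H)"
proof -
  interpret G: pair_graph G by fact
  interpret H: pair_graph H by fact
  have s: "sym (parcs G)" "sym (parcs H)"
    using G.pair_sym_arcs H.pair_sym_arcs by (simp_all add: symmetric_def)
  show ?thesis
  proof
    show "symmetric (with_proj (graph_disj_union G H))"
      using s unfolding symmetric_def sym_def
      by (auto simp: graph_disj_union_def image_iff map_prod_def split_beta) force+
    show "finite (pverts (graph_disj_union G H))" "finite (parcs (graph_disj_union G H))"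
      using G.pair_finite_verts H.pair_finite_verts G.pair_finite_arcs H.pair_finite_arcs
      by (simp_all add: graph_disj_union_def)
    fix e assume "e \<in> parcs (graph_disj_union G H)"
    then consider e' where "e' \<in> parcs G" "e = map_prod Inl Inl e'"
      | e' where "e' \<in> parcs H" "e = map_prod Inr Inr e'"
      unfolding graph_disj_union_def pair_pre_digraph.simps by (elim UnE imageE) simp_all
    then show "fst e \<in> pverts (graph_disj_union G H)" "snd e \<in> pverts (graph_disj_union G H)"
      "fst e \<noteq> snd e"
      using G.arc_fst_in_verts G.arc_snd_in_verts H.arc_fst_in_verts H.arc_snd_in_verts
        G.pair_no_loops H.pair_no_loops
      by (cases; simp add: graph_disj_union_def)+
  qed
qed

lemma pair_graph_join:
  assumes "pair_graph G" "pair_graph H"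
  shows "pair_graph (graph_join G H)"
proof -
  interpret G: pair_graph G by fact
  interpret H: pair_graph H by fact
  interpret U: pair_graph "graph_disj_union G H" by (rule pair_graph_disj_union[OF assms])
  have v: "pverts (graph_disj_union G H) = Inl ` pverts G \<union> Inr ` pverts H"
    by (simp add: graph_disj_union_def)
  have s: "sym (parcs (graph_disj_union G H))"
    using U.pair_sym_arcs by (simp add: symmetric_def)
  show ?thesis
  proof
    show "symmetric (with_proj (graph_join G H))"
      using s unfolding symmetric_def sym_def by (auto simp: graph_join_def)
    show "finite (parcs (graph_join G H))"
      using U.pair_finite_arcs G.pair_finite_verts H.pair_finite_verts
      by (auto simp: graph_join_def)
  qed (use U.pair_finite_verts U.arc_fst_in_verts U.arc_snd_in_verts U.pair_no_loops v
      in \<open>force simp: graph_join_def\<close>)+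
qed

lemma pair_graph_N_graph: "pair_graph (N_graph r)"
  unfolding N_graph_def
  by (intro pair_graph_join pair_graph_disj_union pair_graph_complete_graph
      pair_graph_edgeless_graph)

end

theory Submission
  imports Defs
begin

text \<open>
  The coefficient \<open>a_\<lambda>\<close> counts the proper colorings of one fixed monomial whose exponents are the
  parts of \<open>\<lambda>\<close>, so it is positive exactly when the graph has a proper coloring whose color classes
  have sizes \<open>\<lambda>\<close>.

  Niceness. The \<open>r\<close> vertices of \<open>K_r\<close> together with the two ends of the edge \<open>K_2\<close> form a clique
  with \<open>r + 2\<close> of the \<open>r + 4\<close> vertices, so \<open>a_\<lambda> > 0\<close> forces \<open>\<lambda>\<close> to have at least \<open>r + 2\<close> parts.
  Conversely, the only partitions of \<open>r + 4\<close> with at least \<open>r + 2\<close> parts are \<open>(1,\<dots>,1)\<close>,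
  \<open>(2,1,\<dots>,1)\<close>, \<open>(2,2,1,\<dots>,1)\<close> and \<open>(3,1,\<dots>,1)\<close>, and each of them is realized by coloring
  \<open>K_r\<close> with \<open>r\<close> private colors and choosing which of the four other vertices share a color. Thus
  the support of \<open>a\<close> is cut out by a lower bound on the number of parts. Going down in dominance
  order never decreases the number of parts, so the support is closed downwards.

  Failure of strong niceness. The partition \<open>(3,1,\<dots>,1)\<close> dominates \<open>(2,2,1,\<dots>,1)\<close>, but the
  former has \<open>2 (r + 1)!\<close> colorings and the latter only \<open>4 r!\<close>, which is smaller for \<open>r \<ge> 2\<close>.
  The reason is that in a coloring of type \<open>(2,2,1,\<dots>,1)\<close> both big classes lie outside \<open>K_r\<close>,
  whereas in type \<open>(3,1,\<dots>,1)\<close> one end of \<open>K_2\<close> takes part, alongside the \<open>r\<close> vertices of \<open>K_r\<close>,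
  in the free permutation of the singleton colors. Lemma \<open>card_colorings22_less\<close> turns this into an
  injection that is not surjective, and so avoids computing either number.
\<close>

section \<open>Monomial coefficients count colorings\<close>

lemma exponents_single:
  assumes "k \<noteq> 0"
  shows "exponents (Poly_Mapping.single i k) = {#k#}"
  using assms by (simp add: exponents_def)

lemma exponents_add_disjoint:
  assumes "Poly_Mapping.keys m \<inter> Poly_Mapping.keys m' = {}"
  shows "exponents (m + m') = exponents m + exponents m'"
proof -
  have k: "Poly_Mapping.keys (m + m') = Poly_Mapping.keys m \<union> Poly_Mapping.keys m'"
    by (auto simp: in_keys_iff lookup_add)
  have "image_mset (Poly_Mapping.lookup (m + m')) (mset_set (Poly_Mapping.keys m)) = exponents m"
    unfolding exponents_def
    by (rule image_mset_cong) (use assms in \<open>auto simp: lookup_add in_keys_iff\<close>)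
  moreover have "image_mset (Poly_Mapping.lookup (m + m')) (mset_set (Poly_Mapping.keys m'))
      = exponents m'"
    unfolding exponents_def
    by (rule image_mset_cong) (use assms in \<open>auto simp: lookup_add in_keys_iff\<close>)
  ultimately show ?thesis
    using assms by (simp add: exponents_def[of "m + m'"] k mset_set_Union)
qed

lemma exponents_single_add:
  assumes "k \<noteq> 0" "i \<notin> Poly_Mapping.keys m"
  shows "exponents (Poly_Mapping.single i k + m) = add_mset k (exponents m)"
  using assms by (subst exponents_add_disjoint) (auto simp: exponents_single)

lemma monomial_coeff_eq_card:
  assumes "pair_graph G" "p \<in> partitions_of (card (pverts G))"
    "Poly_Mapping.keys m \<subseteq> {1..}" "exponents m = mset p"
  shows "monomial_coeff G p = int (card {c \<in> proper_colorings G. coloring_monomial G c = m})"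
  using monomial_expansion_coeff[OF is_monomial_expansion_monomial_coeff[OF assms(1)] assms(2-4)]
  by (simp add: chromatic_symfun_def)

lemma monomial_coeff_pos_iff:
  assumes "pair_graph G" "p \<in> partitions_of (card (pverts G))"
  shows "monomial_coeff G p > 0 \<longleftrightarrow>
    (\<exists>c \<in> proper_colorings G. exponents (coloring_monomial G c) = mset p)"
proof -
  interpret pair_graph G by fact
  have fin: "finite (pverts G)" by (rule pair_finite_verts)
  show ?thesis
  proof
    assume pos: "monomial_coeff G p > 0"
    obtain m where m: "Poly_Mapping.keys m \<subseteq> {1..}" "exponents m = mset p"
      using ex_monomial_exponents assms(2) by (auto simp: partitions_of_def)
    have "{c \<in> proper_colorings G. coloring_monomial G c = m} \<noteq> {}"
      using pos monomial_coeff_eq_card[OF assms m] by force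
    then show "\<exists>c \<in> proper_colorings G. exponents (coloring_monomial G c) = mset p"
      using m by auto
  next
    assume "\<exists>c \<in> proper_colorings G. exponents (coloring_monomial G c) = mset p"
    then obtain c where c: "c \<in> proper_colorings G" "exponents (coloring_monomial G c) = mset p"
      by auto
    have k: "Poly_Mapping.keys (coloring_monomial G c) \<subseteq> {1..}"
      using c(1) by (auto simp: keys_coloring_monomial[OF fin] proper_colorings_def PiE_iff)
    have "card {d \<in> proper_colorings G. coloring_monomial G d = coloring_monomial G c} > 0"
      using finite_colorings_with_monomial[OF fin, of "coloring_monomial G c"] c(1)
      by (auto simp: card_gt_0_iff)
    then show "monomial_coeff G p > 0"
      using monomial_coeff_eq_card[OF assms k c(2)] by simp
  qed
qed

text \<open>
  A proper coloring is injective on a clique, and the parts of the partition correspond to the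
  colors used.
\<close>

lemma clique_le_length_of_monomial_coeff_pos:
  assumes "pair_graph G" "p \<in> partitions_of (card (pverts G))" "monomial_coeff G p > 0"
    and "K \<subseteq> pverts G" "\<And>u v. u \<in> K \<Longrightarrow> v \<in> K \<Longrightarrow> u \<noteq> v \<Longrightarrow> (u, v) \<in> parcs G"
  shows "card K \<le> length p"
proof -
  interpret pair_graph G by fact
  have fin: "finite (pverts G)" by (rule pair_finite_verts)
  obtain c where c: "c \<in> proper_colorings G" "exponents (coloring_monomial G c) = mset p"
    using assms(1-3) monomial_coeff_pos_iff by blast
  have "inj_on c K"
    using c(1) assms(5) by (force simp: inj_on_def proper_colorings_def)
  then have "card K \<le> card (c ` pverts G)"
    using card_inj_on_le[of c K "c ` pverts G"] assms(4) fin by auto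
  also have "\<dots> = length p"
    using arg_cong[OF c(2), of size] by (simp add: exponents_def keys_coloring_monomial[OF fin])
  finally show ?thesis .
qed

section \<open>Partitions with almost as many parts as possible\<close>

text \<open>
  The first \<open>length q\<close> parts of the dominating partition already add up to \<open>n\<close>, which leaves
  nothing for further parts.
\<close>

lemma dominates_length_le:
  assumes "p \<in> partitions_of n" "q \<in> partitions_of n" "dominates p q"
  shows "length p \<le> length q"
proof (rule ccontr)
  assume less: "\<not> length p \<le> length q"
  have "sum_list q \<le> sum_list (take (length q) p)"
    using assms(3) unfolding dominates_def by (cases q) (auto dest: spec[of _ "length q"])
  moreover have "sum_list p = sum_list (take (length q) p) + sum_list (drop (length q) p)"
    by (metis append_take_drop_id sum_list_append)
  moreover have "sum_list p = n" "sum_list q = n" using assms(1,2) by (auto simp: partitions_of_def)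
  ultimately have "sum_list (drop (length q) p) = 0" by linarith
  moreover have "p ! length q \<in> set (drop (length q) p)"
    using less by (metis Cons_nth_drop_Suc list.set_intros(1) not_le)
  ultimately have "p ! length q = 0" by auto
  with less assms(1) show False
    unfolding partitions_of_def by (metis (mono_tags, lifting) mem_Collect_eq not_le nth_mem)
qed

text \<open>
  The difference between sum and size is the total by which the entries exceed 1. The induction
  has to follow this excess exactly, because each entry above 1 uses up part of the budget 2; the
  last disjunct absorbs the multisets over budget.
\<close>

lemma multiset_excess_le_2:
  assumes "0 \<notin># M" "sum_mset M \<le> size M + (2::nat)"
  shows "\<exists>k. \<exists>N \<in> {{#}, {#2#}, {#2, 2#}, {#3#}}. M = replicate_mset k 1 + N"
proof -
  have "size M \<le> sum_mset M \<and> (\<exists>k.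
      (sum_mset M = size M \<and> M = replicate_mset k 1) \<or>
      (sum_mset M = size M + 1 \<and> M = replicate_mset k 1 + {#2#}) \<or>
      (sum_mset M = size M + 2 \<and>
        (M = replicate_mset k 1 + {#2, 2#} \<or> M = replicate_mset k 1 + {#3#})) \<or>
      sum_mset M > size M + 2)"
    using assms(1)
  proof (induction M)
    case empty
    show ?case by simp
  next
    case (add x M)
    then have IH: "size M \<le> sum_mset M" and x: "x \<ge> 1" by auto
    obtain k where k: "(sum_mset M = size M \<and> M = replicate_mset k 1) \<or>
      (sum_mset M = size M + 1 \<and> M = replicate_mset k 1 + {#2#}) \<or>
      (sum_mset M = size M + 2 \<and>
        (M = replicate_mset k 1 + {#2, 2#} \<or> M = replicate_mset k 1 + {#3#})) \<or>
      sum_mset M > size M + 2" using add by auto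
    consider "x = 1" | "x = 2" | "x = 3" | "x > 3" using x by linarith
    then show ?case
    proof cases
      case 1
      have "add_mset 1 (replicate_mset k 1 + N) = replicate_mset (Suc k) 1 + N" for N :: "nat multiset"
        by simp
      with k IH 1 show ?thesis by (intro conjI exI[of _ "Suc k"]) auto
    next
      case 2
      with k IH show ?thesis by (intro conjI exI[of _ k]) auto
    next
      case 3
      with k IH show ?thesis by (intro conjI exI[of _ k]) auto
    next
      case 4
      with k IH show ?thesis by (intro conjI exI[of _ k]) auto
    qed
  qed
  with assms(2) show ?thesis by auto
qed

section \<open>The graph and its colorings\<close>

text \<open>
  The hubs are the vertices of \<open>K_r\<close>, each adjacent to all other vertices; \<open>edgev 0\<close> and \<open>edgev 1\<close>
  are joined by the edge of \<open>K_2\<close>, and \<open>isov 0\<close>, \<open>isov 1\<close> come from \<open>2K_1\<close>.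
\<close>

abbreviation "hub k \<equiv> (Inl k :: nat + nat + nat)"
abbreviation "edgev k \<equiv> (Inr (Inl k) :: nat + nat + nat)"
abbreviation "isov k \<equiv> (Inr (Inr k) :: nat + nat + nat)"

lemma pverts_N_graph:
  "pverts (N_graph r) = hub ` {..<r} \<union> {edgev 0, edgev 1, isov 0, isov 1}"
  by (simp add: N_graph_def graph_join_def graph_disj_union_def complete_graph_def
      edgeless_graph_def lessThan_Suc numeral_2_eq_2 insert_commute)

lemma card_N_graph: "card (pverts (N_graph r)) = r + 4"
proof -
  have "card (hub ` {..<r} \<union> {edgev 0, edgev 1, isov 0, isov 1}) = r + 4"
    by (subst card_Un_disjoint) (auto simp: card_image)
  then show ?thesis by (simp only: pverts_N_graph)
qed

lemma finite_pverts_N_graph: "finite (pverts (N_graph r))"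
  by (simp add: pverts_N_graph)

lemma parcs_N_graph:
  "(u, v) \<in> parcs (N_graph r) \<longleftrightarrow>
    u \<in> pverts (N_graph r) \<and> v \<in> pverts (N_graph r) \<and> u \<noteq> v \<and>
    \<not> (u \<in> range isov \<and> v \<in> {edgev 0, edgev 1, isov 0, isov 1}) \<and>
    \<not> (v \<in> range isov \<and> u \<in> {edgev 0, edgev 1, isov 0, isov 1})"
  unfolding pverts_N_graph
  by (cases u rule: sum.exhaust; cases v rule: sum.exhaust)
    (auto simp: N_graph_def graph_join_def graph_disj_union_def complete_graph_def
      edgeless_graph_def less_2_cases_iff split: sum.splits)

lemma connected_N_graph:
  assumes "r \<ge> 1"
  shows "Digraph_Component.connected (with_proj (N_graph r))"
proof -
  interpret pair_graph "N_graph r" by (rule pair_graph_N_graph)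
  have hub: "hub 0 \<in> pverts (N_graph r)" using assms by (simp add: pverts_N_graph)
  have to_hub: "v \<rightarrow>\<^sup>*\<^bsub>with_proj (N_graph r)\<^esub> hub 0" if "v \<in> pverts (N_graph r)" for v
  proof (cases "v = hub 0")
    case False
    with that hub have "(v, hub 0) \<in> parcs (N_graph r)" by (auto simp: parcs_N_graph)
    then show ?thesis by (intro reachable_adjI) (simp add: with_proj_simps arcs_ends_conv)
  qed (use hub in simp)
  show ?thesis
    unfolding connected_def
  proof (rule strongly_connectedI)
    show "verts (with_proj (mk_symmetric (with_proj (N_graph r)))) \<noteq> {}" using hub by auto
    fix u v assume "u \<in> verts (with_proj (mk_symmetric (with_proj (N_graph r))))"
      "v \<in> verts (with_proj (mk_symmetric (with_proj (N_graph r))))"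
    then have "u \<rightarrow>\<^sup>*\<^bsub>with_proj (N_graph r)\<^esub> hub 0" "hub 0 \<rightarrow>\<^sup>*\<^bsub>with_proj (N_graph r)\<^esub> v"
      using to_hub symmetric_reachable' by auto
    then show "u \<rightarrow>\<^sup>*\<^bsub>with_proj (mk_symmetric (with_proj (N_graph r)))\<^esub> v"
      using reachable_trans reachable_mk_symmetric_eq[OF sym_arcs] by metis
  qed
qed

text \<open>
  Explicit colorings use the colors from 5 on for the hubs, which leaves the colors 1 to 4 to the
  four other vertices and keeps the two contributions to the monomial disjoint.
\<close>

definition clique_monomial :: "nat \<Rightarrow> monomial" where
  "clique_monomial r = (\<Sum>k<r. Poly_Mapping.single (k + 5) 1)"

definition explicit_coloring ::
  "nat \<Rightarrow> nat \<Rightarrow> nat \<Rightarrow> nat \<Rightarrow> nat \<Rightarrow> nat + nat + nat \<Rightarrow> nat" where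
  "explicit_coloring r x y z t = restrict
     (case_sum (\<lambda>k. k + 5) (case_sum (\<lambda>k. if k = 0 then x else y) (\<lambda>k. if k = 0 then z else t)))
     (pverts (N_graph r))"

lemma lookup_clique_monomial:
  "Poly_Mapping.lookup (clique_monomial r) i = (if 5 \<le> i \<and> i < r + 5 then 1 else 0)"
proof -
  have "Poly_Mapping.lookup (clique_monomial r) i = (\<Sum>k<r. if k + 5 = i then 1 else 0)"
    by (simp add: clique_monomial_def lookup_sum lookup_single when_def cong: if_cong)
  also have "\<dots> = (\<Sum>k<r. if k = i - 5 then if 5 \<le> i then 1 else 0 else 0)"
    by (rule sum.cong) auto
  also have "\<dots> = (if 5 \<le> i \<and> i < r + 5 then 1 else 0)"
    by auto
  finally show ?thesis .
qed

lemma keys_clique_monomial: "Poly_Mapping.keys (clique_monomial r) = {5..<r + 5}"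
  by (auto simp: in_keys_iff lookup_clique_monomial split: if_splits)

lemma exponents_clique_monomial: "exponents (clique_monomial r) = replicate_mset r 1"
proof -
  have "exponents (clique_monomial r) = image_mset (\<lambda>_. 1) (mset_set {5..<r + 5})"
    unfolding exponents_def keys_clique_monomial
    by (rule image_mset_cong) (simp add: lookup_clique_monomial)
  then show ?thesis by (simp add: image_mset_const_eq)
qed

lemma coloring_monomial_N_graph:
  "coloring_monomial (N_graph r) c = (\<Sum>k<r. Poly_Mapping.single (c (hub k)) 1)
    + (Poly_Mapping.single (c (edgev 0)) 1 + Poly_Mapping.single (c (edgev 1)) 1
      + Poly_Mapping.single (c (isov 0)) 1 + Poly_Mapping.single (c (isov 1)) 1)"
proof -
  have "(\<Sum>v\<in>hub ` {..<r}. Poly_Mapping.single (c v) (1::nat))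
      = (\<Sum>k<r. Poly_Mapping.single (c (hub k)) 1)"
    by (simp add: sum.reindex)
  then show ?thesis
    unfolding coloring_monomial_def pverts_N_graph
    by (subst sum.union_disjoint) (auto simp: add.assoc)
qed

lemma explicit_coloring_simps:
  "k < r \<Longrightarrow> explicit_coloring r x y z t (hub k) = k + 5"
  "explicit_coloring r x y z t (edgev 0) = x" "explicit_coloring r x y z t (edgev 1) = y"
  "explicit_coloring r x y z t (isov 0) = z" "explicit_coloring r x y z t (isov 1) = t"
  by (auto simp: explicit_coloring_def pverts_N_graph)

lemma coloring_monomial_explicit:
  "coloring_monomial (N_graph r) (explicit_coloring r x y z t) = clique_monomial r
    + (Poly_Mapping.single x 1 + Poly_Mapping.single y 1
      + Poly_Mapping.single z 1 + Poly_Mapping.single t 1)"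
  unfolding coloring_monomial_N_graph clique_monomial_def
  by (simp add: explicit_coloring_simps del: One_nat_def)

lemma proper_explicit_coloring:
  assumes "{x, y, z, t} \<subseteq> {1..4}" "x \<noteq> y"
  shows "explicit_coloring r x y z t \<in> proper_colorings (N_graph r)"
proof -
  have "explicit_coloring r x y z t \<in> pverts (N_graph r) \<rightarrow>\<^sub>E {1..}"
    using assms by (auto simp: explicit_coloring_def pverts_N_graph)
  moreover have "explicit_coloring r x y z t u \<noteq> explicit_coloring r x y z t v"
    if "(u, v) \<in> parcs (N_graph r)" for u v
    using that assms unfolding parcs_N_graph pverts_N_graph
    by (auto simp: explicit_coloring_simps simp del: One_nat_def)
  ultimately show ?thesis unfolding proper_colorings_def by blast
qed

section \<open>Niceness\<close>

text \<open>
  Each of the four possible shapes comes from merging colors among the four non-hub vertices in a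
  way that separates the ends of the edge: no merging, one end with an isolated vertex, two such
  pairs, or one end with both isolated vertices.
\<close>

lemma monomial_coeff_N_graph_pos:
  assumes "q \<in> partitions_of (r + 4)" "length q \<ge> r + 2"
  shows "monomial_coeff (N_graph r) q > 0"
proof -
  have "0 \<notin># mset q" "sum_mset (mset q) = r + 4"
    using assms(1) by (auto simp: partitions_of_def sum_mset_sum_list)
  then obtain k N where q: "mset q = replicate_mset k 1 + N" and
    N: "N \<in> {{#}, {#2#}, {#2, 2#}, {#3#}}"
    using multiset_excess_le_2[of "mset q"] assms(2) by (metis add_le_mono1 add.assoc size_mset numeral_Bit0)
  have k: "k + sum_mset N = r + 4"
    using arg_cong[OF q, of sum_mset] \<open>sum_mset (mset q) = r + 4\<close> by simp
  have realize: "monomial_coeff (N_graph r) q > 0"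
    if "{x, y, z, t} \<subseteq> {1..4}" "x \<noteq> y"
      "Poly_Mapping.single x 1 + Poly_Mapping.single y 1
        + Poly_Mapping.single z 1 + Poly_Mapping.single t 1 = m"
      "exponents m + replicate_mset r 1 = mset q" for x y z t :: nat and m :: monomial
  proof -
    have "Poly_Mapping.keys m \<subseteq> {1..4}"
      using that(1,3) by (auto simp: in_keys_iff lookup_add lookup_single when_def split: if_splits)
    then have "Poly_Mapping.keys (clique_monomial r) \<inter> Poly_Mapping.keys m = {}"
      by (auto simp: keys_clique_monomial)
    then have "exponents (coloring_monomial (N_graph r) (explicit_coloring r x y z t)) = mset q"
      unfolding coloring_monomial_explicit that(3) that(4)[symmetric]
      by (subst exponents_add_disjoint) (simp_all add: exponents_clique_monomial add.commute)
    then show ?thesis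
      using monomial_coeff_pos_iff[OF pair_graph_N_graph] assms(1) card_N_graph
        proper_explicit_coloring[OF that(1,2)] by metis
  qed
  consider "N = {#}" "k = Suc (Suc (Suc (Suc r)))" | "N = {#2#}" "k = r + 2" | "N = {#2, 2#}" "k = r"
    | "N = {#3#}" "k = r + 1"
    using N k by (elim insertE emptyE) auto
  then show ?thesis
  proof cases
    case 1
    then show ?thesis
      by (intro realize[of 1 2 3 4 "Poly_Mapping.single 1 1 + (Poly_Mapping.single 2 1
          + (Poly_Mapping.single 3 1 + Poly_Mapping.single 4 1))"])
        (auto intro!: poly_mapping_eqI simp: q exponents_single_add exponents_single in_keys_iff lookup_add lookup_single when_def)
  next
    case 2
    then show ?thesis
      by (intro realize[of 1 2 1 3 "Poly_Mapping.single 1 2 + (Poly_Mapping.single 2 1 + Poly_Mapping.single 3 1)"])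
        (auto intro!: poly_mapping_eqI simp: q exponents_single_add exponents_single in_keys_iff lookup_add lookup_single when_def)
  next
    case 3
    then show ?thesis
      by (intro realize[of 1 2 1 2 "Poly_Mapping.single 1 2 + Poly_Mapping.single 2 2"])
        (auto intro!: poly_mapping_eqI simp: q exponents_single_add exponents_single in_keys_iff lookup_add lookup_single when_def)
  next
    case 4
    then show ?thesis
      by (intro realize[of 1 2 1 1 "Poly_Mapping.single 1 3 + Poly_Mapping.single 2 1"])
        (auto intro!: poly_mapping_eqI simp: q exponents_single_add exponents_single in_keys_iff lookup_add lookup_single when_def)
  qed
qed

lemma nice_N_graph: "nice (N_graph r)"
  unfolding nice_def card_N_graph
proof (intro ballI impI)
  fix p q assume pq: "p \<in> partitions_of (r + 4)" "q \<in> partitions_of (r + 4)" "dominates p q"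
    and pos: "monomial_coeff (N_graph r) p > 0"
  let ?K = "hub ` {..<r} \<union> {edgev 0, edgev 1}"
  have "card ?K = r + 2" by (subst card_Un_disjoint) (auto simp: card_image)
  moreover have "card ?K \<le> length p"
    by (rule clique_le_length_of_monomial_coeff_pos[OF pair_graph_N_graph _ pos])
      (use pq(1) card_N_graph in \<open>auto simp: parcs_N_graph pverts_N_graph\<close>)
  moreover have "length p \<le> length q" using dominates_length_le pq by blast
  ultimately have "length q \<ge> r + 2" by linarith
  then show "monomial_coeff (N_graph r) q > 0" by (rule monomial_coeff_N_graph_pos[OF pq(2)])
qed

section \<open>Failure of strong niceness\<close>

text \<open>
  Color 1 is the class of size 3 and color 2 is one of the singletons, on a par with the colors
  from 5 on.
\<close>

definition monomial31 :: "nat \<Rightarrow> monomial" where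
  "monomial31 r = clique_monomial r + (Poly_Mapping.single 1 3 + Poly_Mapping.single 2 1)"

definition monomial22 :: "nat \<Rightarrow> monomial" where
  "monomial22 r = clique_monomial r + (Poly_Mapping.single 1 2 + Poly_Mapping.single 2 2)"

definition colorings31 :: "nat \<Rightarrow> (nat + nat + nat \<Rightarrow> nat) set" where
  "colorings31 r = {c \<in> proper_colorings (N_graph r). coloring_monomial (N_graph r) c = monomial31 r}"

definition colorings22 :: "nat \<Rightarrow> (nat + nat + nat \<Rightarrow> nat) set" where
  "colorings22 r = {c \<in> proper_colorings (N_graph r). coloring_monomial (N_graph r) c = monomial22 r}"

text \<open>
  The only class with more than one vertex is then an end of the edge together with the two isolated
  vertices, which is a stable set; hence every edge
  meets two different classes.
\<close>

lemma colorings31I: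
  assumes "c \<in> pverts (N_graph r) \<rightarrow>\<^sub>E {1..}" "coloring_monomial (N_graph r) c = monomial31 r"
    and "e \<in> {edgev 0, edgev 1}" "c e = 1" "c (isov 0) = 1" "c (isov 1) = 1"
  shows "c \<in> colorings31 r"
proof -
  have "c u \<noteq> c v" if arc: "(u, v) \<in> parcs (N_graph r)" for u v
  proof
    assume eq: "c u = c v"
    let ?U = "{x \<in> pverts (N_graph r). c x = c u}"
    have fin: "finite ?U" using finite_pverts_N_graph by simp
    have card: "card ?U = Poly_Mapping.lookup (monomial31 r) (c u)"
      using coloring_monomial_lookup[OF finite_pverts_N_graph] assms(2) by metis
    have uv: "u \<noteq> v" "u \<in> pverts (N_graph r)" "v \<in> pverts (N_graph r)"
      using arc by (auto simp: parcs_N_graph)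
    have "card {u, v} \<le> card ?U" using uv eq by (intro card_mono[OF fin]) auto
    then have "card ?U \<ge> 2" using uv by simp
    then have one: "c u = 1" "card ?U = 3"
      by (auto simp: card monomial31_def lookup_add lookup_single when_def lookup_clique_monomial
          split: if_splits)
    have "{e, isov 0, isov 1} = ?U"
    proof (rule card_subset_eq[OF fin])
      show "{e, isov 0, isov 1} \<subseteq> ?U" using assms(3-6) one by (auto simp: pverts_N_graph)
      show "card {e, isov 0, isov 1} = card ?U" using assms(3) one by auto
    qed
    then have "u \<in> {e, isov 0, isov 1}" "v \<in> {e, isov 0, isov 1}" using uv eq by auto
    with arc assms(3) show False by (auto simp: parcs_N_graph)
  qed
  then show ?thesis using assms(1,2) unfolding colorings31_def proper_colorings_def by blast
qed

text \<open>
  A hub is alone in its color class, so the two classes of size 2 fill up the four other vertices.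
  The ends of the edge lie in different classes, and so each class consists of one end and one
  isolated vertex.
\<close>

lemma colorings22D:
  assumes "c \<in> colorings22 r"
  shows "k < r \<Longrightarrow> c (hub k) \<notin> {1, 2}"
    and "c (edgev 0) = 1 \<and> c (edgev 1) = 2 \<or> c (edgev 0) = 2 \<and> c (edgev 1) = 1"
    and "c (isov 0) = 1 \<and> c (isov 1) = 2 \<or> c (isov 0) = 2 \<and> c (isov 1) = 1"
    and "(\<Sum>k<r. Poly_Mapping.single (c (hub k)) 1) = clique_monomial r"
proof -
  let ?U = "\<lambda>i. {x \<in> pverts (N_graph r). c x = i}"
  have fin: "finite (?U i)" for i using finite_pverts_N_graph by simp
  have mon: "coloring_monomial (N_graph r) c = monomial22 r"
    and proper: "c \<in> proper_colorings (N_graph r)"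
    using assms by (auto simp: colorings22_def)
  have neq: "c u \<noteq> c v" if "(u, v) \<in> parcs (N_graph r)" for u v
    using proper that by (auto simp: proper_colorings_def)
  have card: "card (?U i) = 2" if "i \<in> {1, 2}" for i
    using coloring_monomial_lookup[OF finite_pverts_N_graph, of r c i] mon that
    by (auto simp: monomial22_def lookup_add lookup_single when_def lookup_clique_monomial)
  show hub: "c (hub k) \<notin> {1, 2}" if "k < r" for k
  proof
    assume "c (hub k) \<in> {1, 2}"
    then have "card (?U (c (hub k))) = 2" by (rule card)
    then have "\<not> ?U (c (hub k)) \<subseteq> {hub k}"
      using card_mono[of "{hub k}" "?U (c (hub k))"] by auto
    then obtain v where "v \<in> pverts (N_graph r)" "c v = c (hub k)" "v \<noteq> hub k" by auto
    moreover from this have "(v, hub k) \<in> parcs (N_graph r)"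
      using that by (auto simp: parcs_N_graph pverts_N_graph)
    ultimately show False using neq by auto
  qed
  let ?F = "{edgev 0, edgev 1, isov 0, isov 1}"
  have "?U 1 \<union> ?U 2 = ?F"
  proof (rule card_subset_eq)
    show "?U 1 \<union> ?U 2 \<subseteq> ?F"
    proof
      fix v assume v: "v \<in> ?U 1 \<union> ?U 2"
      then have "v \<notin> hub ` {..<r}" using hub by auto
      with v show "v \<in> ?F" by (auto simp: pverts_N_graph)
    qed
    have "card (?U 1 \<union> ?U 2) = 4"
      using card[of 1] card[of 2] fin by (subst card_Un_disjoint) auto
    then show "card (?U 1 \<union> ?U 2) = card ?F" by simp
  qed simp
  then have F: "c v \<in> {1, 2}" if "v \<in> ?F" for v using that by blast
  have "(edgev 0, edgev 1) \<in> parcs (N_graph r)" by (auto simp: parcs_N_graph pverts_N_graph)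
  then show ed: "c (edgev 0) = 1 \<and> c (edgev 1) = 2 \<or> c (edgev 0) = 2 \<and> c (edgev 1) = 1"
    using neq[of "edgev 0" "edgev 1"] F[of "edgev 0"] F[of "edgev 1"] by auto
  have "c (isov 0) \<noteq> c (isov 1)"
  proof
    assume eq: "c (isov 0) = c (isov 1)"
    have "\<exists>e\<in>{edgev 0, edgev 1}. c e = c (isov 0)"
      using ed F[of "isov 0"] by auto
    then obtain e where e: "e \<in> {edgev 0, edgev 1}" "c e = c (isov 0)" by blast
    have "card {e, isov 0, isov 1} \<le> card (?U (c (isov 0)))"
      using e eq by (intro card_mono[OF fin]) (auto simp: pverts_N_graph)
    with card[OF F[of "isov 0"]] e(1) show False by auto
  qed
  then show iso: "c (isov 0) = 1 \<and> c (isov 1) = 2 \<or> c (isov 0) = 2 \<and> c (isov 1) = 1"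
    using F[of "isov 0"] F[of "isov 1"] by auto
  have "Poly_Mapping.single (c (edgev 0)) 1 + Poly_Mapping.single (c (edgev 1)) 1
      = Poly_Mapping.single 1 1 + (Poly_Mapping.single 2 1 :: monomial)"
    "Poly_Mapping.single (c (isov 0)) 1 + Poly_Mapping.single (c (isov 1)) 1
      = Poly_Mapping.single 1 1 + (Poly_Mapping.single 2 1 :: monomial)"
    using ed iso by (auto simp: add.commute)
  then have "Poly_Mapping.single (c (edgev 0)) 1 + Poly_Mapping.single (c (edgev 1)) 1
      + Poly_Mapping.single (c (isov 0)) 1 + Poly_Mapping.single (c (isov 1)) 1
      = Poly_Mapping.single 1 (1 + 1) + (Poly_Mapping.single 2 (1 + 1) :: monomial)"
    unfolding single_add by (simp only: ac_simps)
  then show "(\<Sum>k<r. Poly_Mapping.single (c (hub k)) 1) = clique_monomial r"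
    using mon unfolding coloring_monomial_N_graph monomial22_def one_add_one by simp
qed

text \<open>
  Both a hub and the end of the edge outside the big class carry singleton colors, so their colors
  may be exchanged. Type \<open>(2,2,1,\<dots>,1)\<close> has no such freedom, as there both ends lie in big classes.
\<close>

lemma colorings31_transpose:
  assumes "c \<in> pverts (N_graph r) \<rightarrow>\<^sub>E {1..}" "coloring_monomial (N_graph r) c = monomial31 r"
    and "e \<in> {edgev 0, edgev 1}" "c e = 1" "c (isov 0) = 1" "c (isov 1) = 1"
    and "w \<in> {edgev 0, edgev 1}" "w \<noteq> e" "k < r"
  shows "c \<circ> Transposition.transpose (hub k) w \<in> colorings31 r"
proof -
  let ?t = "Transposition.transpose (hub k) w"
  have V: "hub k \<in> pverts (N_graph r)" "w \<in> pverts (N_graph r)"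
    using assms(7,9) by (auto simp: pverts_N_graph)
  then have perm: "?t permutes pverts (N_graph r)" by (rule permutes_swap_id)
  show ?thesis
  proof (rule colorings31I[of _ _ e])
    show "c \<circ> ?t \<in> pverts (N_graph r) \<rightarrow>\<^sub>E {1..}"
      using assms(1) V by (auto simp: PiE_iff extensional_def Transposition.transpose_def)
    have "coloring_monomial (N_graph r) (c \<circ> ?t) = coloring_monomial (N_graph r) c"
      unfolding coloring_monomial_def
      by (subst sum.permute[OF perm, of "\<lambda>v. Poly_Mapping.single (c v) 1"]) (simp add: comp_def)
    then show "coloring_monomial (N_graph r) (c \<circ> ?t) = monomial31 r" using assms(2) by simp
  qed (use assms in \<open>auto simp: Transposition.transpose_def\<close>)
qed

definition recolor_isolated :: "(nat + nat + nat \<Rightarrow> nat) \<Rightarrow> nat + nat + nat \<Rightarrow> nat" where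
  "recolor_isolated c = c(isov 0 := 1, isov 1 := 1)"

text \<open>
  Moving both isolated vertices to color 1 produces a coloring of type \<open>(3,1,\<dots>,1)\<close> and forgets
  which of them had color 2. That bit is stored by letting hub 0 exchange colors with the end of the
  edge of color 2, or not.
\<close>

definition embed22 :: "(nat + nat + nat \<Rightarrow> nat) \<Rightarrow> nat + nat + nat \<Rightarrow> nat" where
  "embed22 c = (if c (isov 0) = 1 then recolor_isolated c
     else recolor_isolated c \<circ> Transposition.transpose (hub 0) (if c (edgev 0) = 2 then edgev 0 else edgev 1))"

lemma recolor_isolated_colorings22:
  assumes "c \<in> colorings22 r"
  shows "recolor_isolated c \<in> pverts (N_graph r) \<rightarrow>\<^sub>E {1..}"
    "coloring_monomial (N_graph r) (recolor_isolated c) = monomial31 r"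
proof -
  have "c \<in> pverts (N_graph r) \<rightarrow>\<^sub>E {1..}"
    using assms by (simp add: colorings22_def proper_colorings_def)
  then show "recolor_isolated c \<in> pverts (N_graph r) \<rightarrow>\<^sub>E {1..}"
    by (auto simp: recolor_isolated_def PiE_iff extensional_def pverts_N_graph)
  have "Poly_Mapping.single (c (edgev 0)) 1 + Poly_Mapping.single (c (edgev 1)) 1
      + Poly_Mapping.single 1 1 + Poly_Mapping.single 1 1
      = Poly_Mapping.single 1 3 + (Poly_Mapping.single 2 1 :: monomial)"
    using colorings22D(2)[OF assms]
    by (auto intro!: poly_mapping_eqI simp: lookup_add lookup_single when_def)
  then show "coloring_monomial (N_graph r) (recolor_isolated c) = monomial31 r"
    unfolding coloring_monomial_N_graph monomial31_def
    using colorings22D(4)[OF assms] by (simp add: recolor_isolated_def)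
qed

lemma embed22_in_colorings31:
  assumes "c \<in> colorings22 r" "r \<ge> 1"
  shows "embed22 c \<in> colorings31 r"
proof -
  note ed = colorings22D(2)[OF assms(1)] and rec = recolor_isolated_colorings22[OF assms(1)]
  define w where "w = (if c (edgev 0) = 2 then edgev 0 else edgev 1)"
  define e where "e = (if c (edgev 0) = 2 then edgev 1 else edgev 0)"
  have we: "e \<in> {edgev 0, edgev 1}" "w \<in> {edgev 0, edgev 1}" "w \<noteq> e" "recolor_isolated c e = 1"
    using ed by (auto simp: w_def e_def recolor_isolated_def)
  have iso: "recolor_isolated c (isov 0) = 1" "recolor_isolated c (isov 1) = 1" by (simp_all add: recolor_isolated_def)
  show ?thesis
    unfolding embed22_def w_def[symmetric]
    using colorings31I[OF rec we(1,4) iso] colorings31_transpose[OF rec we(1,4) iso we(2,3), of 0]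
      assms(2) by auto
qed

text \<open>
  The first two facts recover the stored bit and the exchanged end from the image. The third one says
  that color 2 never ends up on a hub other than hub 0.
\<close>

lemma embed22_values:
  assumes "c \<in> colorings22 r" "r \<ge> 1"
  shows "c (isov 0) = 1 \<longleftrightarrow> embed22 c (hub 0) \<noteq> 2"
    and "c (isov 0) \<noteq> 1 \<Longrightarrow> c (edgev 0) = 2 \<longleftrightarrow> embed22 c (edgev 0) \<noteq> 1"
    and "k < r \<Longrightarrow> k \<noteq> 0 \<Longrightarrow> embed22 c (hub k) \<noteq> 2"
  using colorings22D[OF assms(1)] colorings22D(1)[OF assms(1), of 0] assms(2)
  by (auto simp: embed22_def recolor_isolated_def Transposition.transpose_def)

lemma inj_on_embed22:
  assumes "r \<ge> 1"
  shows "inj_on embed22 (colorings22 r)"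
proof (rule inj_onI)
  fix c d assume c: "c \<in> colorings22 r" and d: "d \<in> colorings22 r" and eq: "embed22 c = embed22 d"
  have first: "c (isov 0) = 1 \<longleftrightarrow> d (isov 0) = 1"
    using embed22_values(1)[OF c assms] embed22_values(1)[OF d assms] eq by simp
  have "recolor_isolated c = recolor_isolated d"
  proof (cases "c (isov 0) = 1")
    case True
    with first eq show ?thesis by (simp add: embed22_def)
  next
    case False
    with first have "c (edgev 0) = 2 \<longleftrightarrow> d (edgev 0) = 2"
      using embed22_values(2)[OF c assms] embed22_values(2)[OF d assms] eq by simp
    then obtain w where "recolor_isolated c \<circ> Transposition.transpose (hub 0) w
        = recolor_isolated d \<circ> Transposition.transpose (hub 0) w"
      using False first eq by (auto simp: embed22_def split: if_splits)
    then have "recolor_isolated c \<circ> (Transposition.transpose (hub 0) w \<circ> Transposition.transpose (hub 0) w)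
        = recolor_isolated d \<circ> (Transposition.transpose (hub 0) w \<circ> Transposition.transpose (hub 0) w)"
      by (simp only: o_assoc)
    then show ?thesis by simp
  qed
  moreover have "c (isov 0) = d (isov 0)" "c (isov 1) = d (isov 1)"
    using first colorings22D(3)[OF c] colorings22D(3)[OF d] by auto
  ultimately have "(recolor_isolated c)(isov 0 := c (isov 0), isov 1 := c (isov 1))
      = (recolor_isolated d)(isov 0 := d (isov 0), isov 1 := d (isov 1))" by simp
  then show "c = d" by (simp add: recolor_isolated_def fun_upd_twist)
qed

text \<open>
  Since \<open>r \<ge> 2\<close> there is a hub 1, and a coloring of type \<open>(3,1,\<dots>,1)\<close> that gives color 2 to it is
  missed by the injection.
\<close>

lemma card_colorings22_less:
  assumes "r \<ge> 2"
  shows "card (colorings22 r) < card (colorings31 r)"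
proof -
  have fin: "finite (colorings31 r)"
    unfolding colorings31_def by (rule finite_colorings_with_monomial[OF finite_pverts_N_graph])
  let ?c = "explicit_coloring r 1 2 1 1"
  let ?d = "?c \<circ> Transposition.transpose (hub 1) (edgev 1)"
  have "?c \<in> proper_colorings (N_graph r)" by (rule proper_explicit_coloring) auto
  then have c: "?c \<in> pverts (N_graph r) \<rightarrow>\<^sub>E {1..}" by (simp add: proper_colorings_def)
  have "Poly_Mapping.single 1 1 + Poly_Mapping.single 2 1
      + Poly_Mapping.single 1 1 + Poly_Mapping.single 1 1
      = Poly_Mapping.single 1 3 + (Poly_Mapping.single 2 1 :: monomial)"
    by (auto intro!: poly_mapping_eqI simp: lookup_add lookup_single when_def)
  then have "coloring_monomial (N_graph r) ?c = monomial31 r"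
    unfolding coloring_monomial_explicit monomial31_def by simp
  then have d: "?d \<in> colorings31 r"
    by (rule colorings31_transpose[of _ _ "edgev 0", OF c])
      (use assms explicit_coloring_simps(2-5) in auto)
  have "?d (hub 1) = 2" using explicit_coloring_simps(3) by simp
  then have "?d \<notin> embed22 ` colorings22 r"
    using embed22_values(3)[of _ r 1] assms by (fastforce simp del: o_apply)
  then have "embed22 ` colorings22 r \<subseteq> colorings31 r - {?d}"
    using embed22_in_colorings31[OF _ order_trans[OF one_le_numeral assms]] by blast
  then have "card (colorings22 r) \<le> card (colorings31 r - {?d})"
    using inj_on_embed22[of r] assms fin by (intro card_inj_on_le[of embed22]) auto
  also have "\<dots> < card (colorings31 r)" using fin d by (rule card_Diff1_less)
  finally show ?thesis .
qed

lemma not_strongly_nice_N_graph: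
  assumes "r \<ge> 2"
  shows "\<not> strongly_nice (N_graph r)"
proof
  assume strong: "strongly_nice (N_graph r)"
  let ?p = "3 # 1 # replicate r (1::nat)" and ?q = "2 # 2 # replicate r (1::nat)"
  have ones: "sorted_wrt (\<ge>) (replicate r (1::nat))" by (induction r) auto
  have p: "?p \<in> partitions_of (card (pverts (N_graph r)))"
    and q: "?q \<in> partitions_of (card (pverts (N_graph r)))"
    unfolding card_N_graph partitions_of_def using ones by (auto simp: sum_list_replicate)
  have "dominates ?p ?q"
    unfolding dominates_def
  proof (intro allI impI)
    fix k :: nat assume "k \<ge> 1"
    then consider "k = 1" | j where "k = Suc (Suc j)" by (metis One_nat_def Suc_le_D le_SucE not0_implies_Suc)
    then show "sum_list (take k ?q) \<le> sum_list (take k ?p)" by cases auto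
  qed
  then have le: "monomial_coeff (N_graph r) ?p \<le> monomial_coeff (N_graph r) ?q"
    using strong p q unfolding strongly_nice_def by blast
  have dis: "Poly_Mapping.keys (clique_monomial r)
      \<inter> Poly_Mapping.keys (Poly_Mapping.single 1 a + Poly_Mapping.single (2::nat) b) = {}" for a b :: nat
    by (auto simp: keys_clique_monomial in_keys_iff lookup_add lookup_single when_def split: if_splits)
  have exps: "exponents (Poly_Mapping.single 1 a + Poly_Mapping.single 2 b) = {#a, b#}"
    if "a \<noteq> 0" "b \<noteq> 0" for a b
    using that by (subst exponents_add_disjoint) (auto simp: exponents_single)
  have keys: "Poly_Mapping.keys (clique_monomial r
      + (Poly_Mapping.single 1 a + Poly_Mapping.single 2 b)) \<subseteq> {1..}" for a b
    by (auto simp: in_keys_iff lookup_add lookup_single when_def lookup_clique_monomial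
        split: if_splits)
  have "exponents (monomial31 r) = mset ?p" "exponents (monomial22 r) = mset ?q"
    unfolding monomial31_def monomial22_def exponents_add_disjoint[OF dis]
    by (simp_all only: exps exponents_clique_monomial) simp_all
  then have "monomial_coeff (N_graph r) ?p = int (card (colorings31 r))"
    "monomial_coeff (N_graph r) ?q = int (card (colorings22 r))"
    unfolding colorings31_def colorings22_def
    using keys monomial_coeff_eq_card[OF pair_graph_N_graph p]
      monomial_coeff_eq_card[OF pair_graph_N_graph q]
    by (simp_all only: monomial31_def monomial22_def)
  with le card_colorings22_less[OF assms] show False by simp
qed

theorem theorem1p4:
  fixes r :: nat
  assumes "r \<ge> 2"
  shows "Digraph_Component.connected (with_proj (N_graph r)) \<and> nice (N_graph r)
    \<and> \<not> strongly_nice (N_graph r)"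
  using connected_N_graph nice_N_graph not_strongly_nice_N_graph assms by auto

end
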